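(* Let $\mathbf\Sigma$ be a positive definite $p\times p$ covariance matrix with precision matrix $\mathbf P=\mathbf\Sigma^{-1}$, and let $\mathbf s\in\mathbb R^p$ be given by $s_j=\mathbf P_{jj}^{-1}$, $j=1,\dots,p$. Then the $2p\times2p$ matrix $$\underline{\mathbf\Sigma}=\begin{bmatrix}\mathbf\Sigma&\mathbf\Sigma-\mathrm{diag}(\mathbf s)\\ \mathbf\Sigma-\mathrm{diag}(\mathbf s)&\mathbf\Sigma\end{bmatrix}$$ is positive semidefinite if either 1. $\mathbf\Sigma$ is the covariance matrix of a (Gaussian) tree graphical model; or 2. $\mathbf P$ is diagonally dominant.
   Context: $\mathrm{diag}(\mathbf s)$ is the diagonal matrix with diagonal entries $s_1,\dots,s_p$. $\mathbf\Sigma$ is the covariance matrix of a Gaussian tree graphical model if there is a tree on the vertex set $\{1,\dots,p\}$ such that $\mathbf P_{jk}=0$ whenever $j\ne k$ are not adjacent in the tree. $\mathbf P$ is diagonally dominant if $|\mathbf P_{jj}|\ge\sum_{k\ne j}|\mathbf P_{jk}|$ for every $j$. *)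

theory Defs
  imports "HOL-Analysis.Analysis"
begin

text \<open>Definiteness includes symmetry, as usual for covariance matrices.\<close>

definition pos_def :: "real ^ 'n ^ 'n \<Rightarrow> bool" where
  "pos_def A \<longleftrightarrow> transpose A = A \<and> (\<forall>x. x \<noteq> 0 \<longrightarrow> 0 < x \<bullet> (A *v x))"

definition pos_semidef :: "real ^ 'n ^ 'n \<Rightarrow> bool" where
  "pos_semidef A \<longleftrightarrow> transpose A = A \<and> (\<forall>x. 0 \<le> x \<bullet> (A *v x))"

definition diag_mat :: "real ^ 'n \<Rightarrow> real ^ 'n ^ 'n" where
  "diag_mat s = (\<chi> i j. if i = j then s $ i else 0)"

text \<open>The rows and columns of the block matrix \<open>[A, B; C, D]\<close> are indexed by the sum type
  \<open>'n + 'n\<close>, which has \<open>2 * CARD('n)\<close> elements: \<open>Inl\<close> is the first half of the indices,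
  \<open>Inr\<close> the second half.\<close>

definition block_mat ::
  "real ^ 'n ^ 'n \<Rightarrow> real ^ 'n ^ 'n \<Rightarrow> real ^ 'n ^ 'n \<Rightarrow> real ^ 'n ^ 'n \<Rightarrow> real ^ ('n + 'n) ^ ('n + 'n)"
where
  "block_mat A B C D = (\<chi> i j.
     case i of
       Inl a \<Rightarrow> (case j of Inl b \<Rightarrow> A $ a $ b | Inr b \<Rightarrow> B $ a $ b)
     | Inr a \<Rightarrow> (case j of Inl b \<Rightarrow> C $ a $ b | Inr b \<Rightarrow> D $ a $ b))"

definition diag_dominant :: "real ^ 'n ^ 'n \<Rightarrow> bool" where
  "diag_dominant A \<longleftrightarrow> (\<forall>j. (\<Sum>k\<in>UNIV - {j}. \<bar>A $ j $ k\<bar>) \<le> \<bar>A $ j $ j\<bar>)"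

text \<open>A simple graph on the vertex set \<open>UNIV\<close> is given by its adjacency relation, which is
  symmetric and irreflexive. A cycle is listed without repeating its first vertex and has at
  least three vertices, so traversing one edge back and forth is not a cycle.\<close>

definition graph_cycle :: "('a \<Rightarrow> 'a \<Rightarrow> bool) \<Rightarrow> 'a list \<Rightarrow> bool" where
  "graph_cycle E vs \<longleftrightarrow>
     3 \<le> length vs \<and> distinct vs \<and> successively E vs \<and> E (last vs) (hd vs)"

definition tree :: "('a \<Rightarrow> 'a \<Rightarrow> bool) \<Rightarrow> bool" where
  "tree E \<longleftrightarrow> symp E \<and> irreflp E \<and> (\<forall>u v. E\<^sup>*\<^sup>* u v) \<and> (\<nexists>vs. graph_cycle E vs)"

definition tree_graphical_model :: "real ^ 'n ^ 'n \<Rightarrow> bool" where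
  "tree_graphical_model \<Sigma> \<longleftrightarrow>
     (\<exists>E. tree E \<and> (\<forall>j k. j \<noteq> k \<and> \<not> E j k \<longrightarrow> matrix_inv \<Sigma> $ j $ k = 0))"

end

theory Submission
  imports Defs
begin

text \<open>Conjugating by the orthogonal matrix \<open>[I, I; I, -I] / \<surd>2\<close>, the block matrix is positive
  semidefinite iff \<open>diag s\<close> and \<open>2 \<Sigma> - diag s\<close> are, and by inversion the latter means
  \<open>P \<le> 2 diag P\<close> in the Loewner order. Under diagonal dominance this is the estimate
  \<open>2 x\<^sub>i x\<^sub>j \<le> x\<^sub>i\<^sup>2 + x\<^sub>j\<^sup>2\<close>. For a tree, a proper two-colouring gives signs for which flipping
  \<open>x\<close> negates exactly the off-diagonal part of the quadratic form of \<open>P\<close>, so that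
  \<open>2 diag P - P\<close> is congruent to \<open>P\<close>.\<close>

lemma quadratic_form_sum:
  fixes A :: "real ^ 'n ^ 'n"
  shows "x \<bullet> (A *v x) = (\<Sum>i\<in>UNIV. \<Sum>j\<in>UNIV. A $ i $ j * (x $ i * x $ j))"
  by (simp add: inner_vec_def matrix_vector_mult_def sum_distrib_left mult_ac)

lemma diag_mat_mult: "diag_mat s *v x = (\<chi> i. s $ i * x $ i)"
  by (simp add: vec_eq_iff diag_mat_def matrix_vector_mult_def if_distrib[of "\<lambda>a. a * _"] cong: if_cong)

lemma sum_UNIV_sum_type:
  "(\<Sum>k\<in>(UNIV :: ('a::finite + 'b::finite) set). f k) = (\<Sum>i\<in>UNIV. f (Inl i)) + (\<Sum>i\<in>UNIV. f (Inr i))"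
  by (simp add: UNIV_Plus_UNIV[symmetric] sum.Plus del: UNIV_Plus_UNIV)

text \<open>For the two halves \<open>u\<close>, \<open>v\<close> of a vector, the coordinates
  \<open>u + v\<close> and \<open>u - v\<close> decouple the form: twice its value is the form of
  \<open>A + B\<close> at \<open>u + v\<close> plus that of \<open>A - B\<close> at
  \<open>u - v\<close>.\<close>

lemma pos_semidef_block_mat:
  fixes A B :: "real ^ 'n ^ 'n"
  assumes plus: "pos_semidef (A + B)" and minus: "pos_semidef (A - B)"
  shows "pos_semidef (block_mat A B B A)"
proof -
  \<comment> \<open>Adding and subtracting these two identities gives the symmetry of
    \<open>A\<close> and \<open>B\<close> separately.\<close>
  have "A $ i $ j + B $ i $ j = A $ j $ i + B $ j $ i"
    and "A $ i $ j - B $ i $ j = A $ j $ i - B $ j $ i" for i j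
    using plus minus by (simp_all add: pos_semidef_def vec_eq_iff transpose_def)
  then have sym: "A $ i $ j = A $ j $ i" "B $ i $ j = B $ j $ i" for i j
    by (smt (verit))+
  have "transpose (block_mat A B B A) = block_mat A B B A"
    by (auto simp: vec_eq_iff transpose_def block_mat_def sym split: sum.split)
  moreover have "0 \<le> w \<bullet> (block_mat A B B A *v w)" for w
  proof -
    define u v where "u = (\<chi> i. w $ Inl i)" and "v = (\<chi> i. w $ Inr i)"
    have "2 * (w \<bullet> (block_mat A B B A *v w)) =
        (u + v) \<bullet> ((A + B) *v (u + v)) + (u - v) \<bullet> ((A - B) *v (u - v))"
      unfolding quadratic_form_sum sum_UNIV_sum_type
      by (simp add: block_mat_def u_def v_def sum_distrib_left flip: sum.distrib)
        (simp add: algebra_simps)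
    moreover have "0 \<le> (u + v) \<bullet> ((A + B) *v (u + v))" "0 \<le> (u - v) \<bullet> ((A - B) *v (u - v))"
      using plus minus by (auto simp: pos_semidef_def)
    ultimately show ?thesis by linarith
  qed
  ultimately show ?thesis by (simp add: pos_semidef_def)
qed

text \<open>A positive definite matrix has trivial kernel, hence an inverse. The form of the inverse
  at \<open>x\<close> is the form of \<open>A\<close> at the preimage of \<open>x\<close> under
  \<open>A\<close>.\<close>

lemma pos_def_inverse:
  fixes A :: "real ^ 'n ^ 'n"
  assumes "pos_def A"
  shows "A ** matrix_inv A = mat 1" and "pos_def (matrix_inv A)"
proof -
  let ?P = "matrix_inv A"
  have sym: "transpose A = A" and pos: "x \<noteq> 0 \<Longrightarrow> 0 < x \<bullet> (A *v x)" for x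
    using assms by (auto simp: pos_def_def)
  have "x = 0" if "A *v x = 0" for x
    using pos[of x] that by auto
  then have "invertible A"
    by (metis invertible_left_inverse matrix_left_invertible_ker)
  then show inv: "A ** ?P = mat 1"
    unfolding invertible_def matrix_inv_def by (rule someI2_ex) simp
  have "transpose ?P = transpose ?P ** (A ** ?P)"
    by (simp add: inv)
  also have "\<dots> = transpose (A ** ?P) ** ?P"
    by (simp add: matrix_transpose_mul sym matrix_mul_assoc)
  also have "\<dots> = ?P"
    by (simp add: inv)
  finally have "transpose ?P = ?P" .
  moreover have "0 < x \<bullet> (?P *v x)" if "x \<noteq> 0" for x
  proof -
    have x: "A *v (?P *v x) = x"
      by (simp add: matrix_vector_mul_assoc inv)
    with that have "?P *v x \<noteq> 0" by auto
    from pos[OF this] show ?thesis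
      by (simp add: x inner_commute)
  qed
  ultimately show "pos_def ?P" by (simp add: pos_def_def)
qed

lemma pos_def_diag_pos:
  assumes "pos_def A"
  shows "0 < A $ j $ j"
proof -
  have "0 < axis j 1 \<bullet> (A *v axis j 1)"
    using assms by (simp add: pos_def_def axis_eq_0_iff)
  then show ?thesis
    by (simp add: inner_axis' matrix_vector_mul_component inner_axis)
qed

text \<open>Each term is split evenly between the squares of its two coordinates. The weight
  collected by a coordinate is then its full absolute row sum, which is at most twice the diagonal
  entry.\<close>

lemma quadratic_form_le_diag_if_diag_dominant:
  assumes sym: "transpose A = A" and dom: "diag_dominant A" and nonneg: "\<And>j. 0 \<le> A $ j $ j"
  shows "x \<bullet> (A *v x) \<le> 2 * (\<Sum>j\<in>UNIV. A $ j $ j * (x $ j)\<^sup>2)"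
proof -
  have symc: "A $ i $ j = A $ j $ i" for i j
    using sym by (metis transpose_def vec_lambda_beta)
  have row: "(\<Sum>j\<in>UNIV. \<bar>A $ i $ j\<bar>) \<le> 2 * A $ i $ i" for i
  proof -
    have "(\<Sum>j\<in>UNIV. \<bar>A $ i $ j\<bar>) = \<bar>A $ i $ i\<bar> + (\<Sum>j\<in>UNIV - {i}. \<bar>A $ i $ j\<bar>)"
      by (simp add: sum.remove)
    with dom nonneg[of i] show ?thesis
      unfolding diag_dominant_def by (metis abs_of_nonneg add_left_mono mult_2)
  qed
  have "A $ i $ j * (x $ i * x $ j) \<le> \<bar>A $ i $ j\<bar> * (x $ i)\<^sup>2 / 2 + \<bar>A $ i $ j\<bar> * (x $ j)\<^sup>2 / 2" for i j
  proof -
    have "\<bar>x $ i * x $ j\<bar> \<le> ((x $ i)\<^sup>2 + (x $ j)\<^sup>2) / 2"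
      using sum_squares_bound[of "\<bar>x $ i\<bar>" "\<bar>x $ j\<bar>"] by (simp add: abs_mult)
    then have "\<bar>A $ i $ j\<bar> * \<bar>x $ i * x $ j\<bar> \<le> \<bar>A $ i $ j\<bar> * (((x $ i)\<^sup>2 + (x $ j)\<^sup>2) / 2)"
      by (intro mult_left_mono) auto
    then show ?thesis
      by (simp add: abs_mult[symmetric] field_simps del: abs_mult)
  qed
  then have "x \<bullet> (A *v x) \<le>
      (\<Sum>i\<in>UNIV. \<Sum>j\<in>UNIV. \<bar>A $ i $ j\<bar> * (x $ i)\<^sup>2 / 2 + \<bar>A $ i $ j\<bar> * (x $ j)\<^sup>2 / 2)"
    unfolding quadratic_form_sum by (intro sum_mono)
  also have "\<dots> = (\<Sum>i\<in>UNIV. \<Sum>j\<in>UNIV. \<bar>A $ i $ j\<bar> * (x $ i)\<^sup>2 / 2)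
      + (\<Sum>j\<in>UNIV. \<Sum>i\<in>UNIV. \<bar>A $ i $ j\<bar> * (x $ j)\<^sup>2 / 2)"
    by (simp add: sum.distrib) (rule sum.swap)
  \<comment> \<open>By symmetry column sums equal row sums, so the two halves coincide and add
    up.\<close>
  also have "\<dots> = (\<Sum>i\<in>UNIV. (\<Sum>j\<in>UNIV. \<bar>A $ i $ j\<bar>) * (x $ i)\<^sup>2)"
    by (subst (2) symc)
      (simp add: sum_distrib_right flip: sum.distrib)
  also have "\<dots> \<le> (\<Sum>i\<in>UNIV. (2 * A $ i $ i) * (x $ i)\<^sup>2)"
    by (intro sum_mono mult_right_mono row) simp
  finally show ?thesis
    by (simp add: sum_distrib_left mult.assoc)
qed

text \<open>The first vertex of a longest path is a leaf: a neighbour lies on the path by maximality,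
  and closes a cycle unless it is the second vertex.\<close>

lemma acyclic_graph_has_leaf:
  assumes "finite V" "V \<noteq> {}" and sym: "symp E" and irr: "irreflp E"
    and acyc: "\<nexists>vs. graph_cycle E vs"
  shows "\<exists>x\<in>V. \<forall>y\<in>V. \<forall>z\<in>V. E x y \<longrightarrow> E x z \<longrightarrow> y = z"
proof -
  define path where "path vs \<longleftrightarrow> vs \<noteq> [] \<and> set vs \<subseteq> V \<and> distinct vs \<and> successively E vs" for vs
  obtain v where "v \<in> V" using \<open>V \<noteq> {}\<close> by auto
  then have "path [v]" by (simp add: path_def)
  moreover have "\<forall>vs. path vs \<longrightarrow> length vs < Suc (card V)"
    unfolding path_def using \<open>finite V\<close> by (metis card_mono distinct_card less_Suc_eq_le)
  ultimately obtain vs where vs: "path vs" and longest: "\<And>ws. path ws \<Longrightarrow> length ws \<le> length vs"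
    using ex_has_greatest_nat[of path "[v]" length] by blast
  then obtain x ws where vs_eq: "vs = x # ws"
    by (cases vs) (auto simp: path_def)
  \<comment> \<open>For empty \<open>ws\<close> the value \<open>hd ws\<close> is unspecified, but
    then \<open>x\<close> has no neighbour in \<open>V\<close> and the claim is vacuous.\<close>
  have "y = hd ws" if "y \<in> V" "E x y" for y
  proof (rule ccontr)
    assume "y \<noteq> hd ws"
    have "E y x" using sym \<open>E x y\<close> by (simp add: sympD)
    have "\<not> path (y # vs)"
      using longest by fastforce
    then have "y \<in> set vs"
      using vs \<open>E y x\<close> \<open>y \<in> V\<close> by (auto simp: path_def vs_eq)
    moreover have "y \<noteq> x"
      using irr \<open>E x y\<close> by (auto dest: irreflpD)
    ultimately obtain as bs where ws: "ws = as @ y # bs"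
      by (metis set_ConsD split_list vs_eq)
    \<comment> \<open>A vertex strictly between \<open>x\<close> and \<open>y\<close> gives the
      cycle its required length of three.\<close>
    with \<open>y \<noteq> hd ws\<close> have "as \<noteq> []" by auto
    moreover have "distinct (x # as @ [y])" "successively E (x # as @ [y])"
      using vs \<open>as \<noteq> []\<close>
      by (auto simp: path_def vs_eq ws successively_Cons successively_append_iff)
    ultimately have "graph_cycle E (x # as @ [y])"
      using \<open>E y x\<close> by (auto simp: graph_cycle_def Suc_le_eq)
    with acyc show False by blast
  qed
  moreover have "x \<in> V" using vs by (simp add: path_def vs_eq)
  ultimately show ?thesis by metis
qed

text \<open>Remove a leaf, colour the rest, and give the leaf the colour opposite to its neighbour.
  Acyclicity concerns the whole graph, so it is available for every subset \<open>V\<close> in the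
  induction.\<close>

lemma acyclic_graph_two_colouring:
  assumes "finite V" and sym: "symp E" and irr: "irreflp E" and acyc: "\<nexists>vs. graph_cycle E vs"
  shows "\<exists>c :: 'a \<Rightarrow> bool. \<forall>u\<in>V. \<forall>v\<in>V. E u v \<longrightarrow> c u \<noteq> c v"
  using \<open>finite V\<close>
proof (induction V rule: finite_psubset_induct)
  case (psubset V)
  show ?case
  proof (cases "V = {}")
    case False
    obtain x where x: "x \<in> V"
      and leaf: "\<And>y z. y \<in> V \<Longrightarrow> z \<in> V \<Longrightarrow> E x y \<Longrightarrow> E x z \<Longrightarrow> y = z"
      using acyclic_graph_has_leaf[OF psubset.hyps(1) False sym irr acyc] by metis
    have "V - {x} \<subset> V" using x by auto
    from psubset.IH[OF this] obtain c :: "'a \<Rightarrow> bool"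
      where c: "\<And>u v. u \<in> V - {x} \<Longrightarrow> v \<in> V - {x} \<Longrightarrow> E u v \<Longrightarrow> c u \<noteq> c v"
      by blast
    \<comment> \<open>As \<open>x\<close> has at most one neighbour in \<open>V\<close>, this
      negates that neighbour's colour; an isolated \<open>x\<close> gets
      \<open>False\<close>.\<close>
    define c' where "c' = c(x := (\<exists>y\<in>V. E x y \<and> \<not> c y))"
    have leaf_colour: "c' x \<noteq> c' v" if "v \<in> V" "E x v" for v
    proof -
      have "v \<noteq> x" using irr that by (auto dest: irreflpD)
      moreover have "(\<exists>y\<in>V. E x y \<and> \<not> c y) \<longleftrightarrow> \<not> c v"
        using leaf that by blast
      ultimately show ?thesis by (simp add: c'_def)
    qed
    have "c' u \<noteq> c' v" if "u \<in> V" "v \<in> V" "E u v" for u v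
    proof -
      consider "u = x" | "v = x" | "u \<noteq> x" "v \<noteq> x" by blast
      then show ?thesis
      proof cases
        case 1
        then show ?thesis using leaf_colour that by simp
      next
        case 2
        then show ?thesis using leaf_colour[of u] that sympD[OF sym] by blast
      next
        case 3
        then show ?thesis using c[of u v] that by (simp add: c'_def)
      qed
    qed
    then show ?thesis by blast
  qed simp
qed

text \<open>Edges join different colours, so flipping signs on one colour class negates the
  off-diagonal terms and keeps the diagonal ones. The forms at \<open>x\<close> and at the flipped
  \<open>y\<close> add up to twice the diagonal part, and the form at \<open>y\<close> is
  nonnegative.\<close>

lemma quadratic_form_le_diag_if_tree:
  fixes A :: "real ^ 'n ^ 'n"
  assumes pos: "\<And>x. 0 \<le> x \<bullet> (A *v x)" and "tree E"
    and supp: "\<And>j k. j \<noteq> k \<Longrightarrow> \<not> E j k \<Longrightarrow> A $ j $ k = 0"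
  shows "x \<bullet> (A *v x) \<le> 2 * (\<Sum>j\<in>UNIV. A $ j $ j * (x $ j)\<^sup>2)"
proof -
  obtain c :: "'n \<Rightarrow> bool" where c: "\<And>u v. E u v \<Longrightarrow> c u \<noteq> c v"
    using acyclic_graph_two_colouring[of UNIV E] \<open>tree E\<close> unfolding tree_def by auto
  define y where "y = (\<chi> i. if c i then x $ i else - x $ i)"
  have "A $ i $ j * (x $ i * x $ j) + A $ i $ j * (y $ i * y $ j) =
      (if i = j then 2 * (A $ i $ i * (x $ i)\<^sup>2) else 0)" for i j
    using c[of i j] supp[of i j] by (auto simp: y_def power2_eq_square)
  then have "x \<bullet> (A *v x) + y \<bullet> (A *v y) = 2 * (\<Sum>j\<in>UNIV. A $ j $ j * (x $ j)\<^sup>2)"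
    by (simp add: quadratic_form_sum sum_distrib_left flip: sum.distrib)
  with pos[of y] show ?thesis by linarith
qed

text \<open>Expand the square \<open>0 \<le> (x - P z / 2) \<bullet> A (x - P z / 2)\<close> for \<open>z = diag s x\<close>.\<close>

lemma quadratic_form_ge_diag_inverse:
  fixes A P :: "real ^ 'n ^ 'n"
  assumes A: "pos_def A" and inv: "A ** P = mat 1"
    and diag: "\<And>j. 0 < P $ j $ j"
    and le: "\<And>x. x \<bullet> (P *v x) \<le> 2 * (\<Sum>j\<in>UNIV. P $ j $ j * (x $ j)\<^sup>2)"
    and s: "\<And>j. s $ j = inverse (P $ j $ j)"
  shows "x \<bullet> (diag_mat s *v x) \<le> 2 * (x \<bullet> (A *v x))"
proof -
  define z w where "z = diag_mat s *v x" and "w = P *v z"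
  have Aw: "A *v w = z"
    by (simp add: w_def matrix_vector_mul_assoc inv)
  \<comment> \<open>The choice of \<open>s\<close> as inverse diagonal turns the diagonal bound at
    \<open>z\<close> into a multiple of \<open>x \<bullet> z\<close>.\<close>
  have "P $ j $ j * (z $ j)\<^sup>2 = x $ j * z $ j" for j
    using diag[of j] by (simp add: z_def diag_mat_mult s power2_eq_square)
  then have zw: "z \<bullet> w \<le> 2 * (x \<bullet> z)"
    using le[of z] by (simp add: w_def inner_vec_def)
  \<comment> \<open>Symmetry moves \<open>A\<close> onto \<open>w\<close>, where it gives
    \<open>z\<close>.\<close>
  have "w \<bullet> (A *v x) = x \<bullet> z"
    using A Aw by (metis dot_lmul_matrix inner_commute pos_def_def vector_transpose_matrix)
  moreover have "0 \<le> (x - (1/2) *\<^sub>R w) \<bullet> (A *v (x - (1/2) *\<^sub>R w))"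
    using A by (cases "x - (1/2) *\<^sub>R w = 0") (auto simp: pos_def_def less_imp_le)
  ultimately have "0 \<le> x \<bullet> (A *v x) - x \<bullet> z + (z \<bullet> w) / 4"
    by (simp add: matrix_vector_mult_diff_distrib matrix_vector_mult_scaleR Aw
        inner_diff_left inner_diff_right inner_commute[of w z])
  \<comment> \<open>Bounding \<open>z \<bullet> w\<close> by \<open>2 * (x \<bullet> z)\<close>
    leaves half of \<open>x \<bullet> z\<close> below \<open>x \<bullet> (A *v x)\<close>.\<close>
  with zw show ?thesis
    unfolding z_def[symmetric] by linarith
qed

theorem theorem7:
  fixes \<Sigma> P :: "real ^ 'p ^ 'p" and s :: "real ^ 'p"
  assumes "pos_def \<Sigma>"
    and "P = matrix_inv \<Sigma>"
    and "\<And>j. s $ j = inverse (P $ j $ j)"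
    and "tree_graphical_model \<Sigma> \<or> diag_dominant P"
  shows "pos_semidef (block_mat \<Sigma> (\<Sigma> - diag_mat s) (\<Sigma> - diag_mat s) \<Sigma>)"
proof -
  have inv: "\<Sigma> ** P = mat 1" and P: "pos_def P"
    using pos_def_inverse[OF assms(1)] assms(2) by auto
  note diag = pos_def_diag_pos[OF P]
  have pos: "0 \<le> x \<bullet> (P *v x)" for x
    using P by (cases "x = 0") (auto simp: pos_def_def less_imp_le)
  \<comment> \<open>Both alternatives enter only through this common bound.\<close>
  have le: "x \<bullet> (P *v x) \<le> 2 * (\<Sum>j\<in>UNIV. P $ j $ j * (x $ j)\<^sup>2)" for x
    using assms(4)
  proof
    assume "tree_graphical_model \<Sigma>"
    then show ?thesis
      unfolding tree_graphical_model_def assms(2)[symmetric]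
      using quadratic_form_le_diag_if_tree[OF pos] by blast
  next
    assume "diag_dominant P"
    then show ?thesis
      using P diag by (intro quadratic_form_le_diag_if_diag_dominant)
        (auto simp: pos_def_def less_imp_le)
  qed
  have D_sym: "transpose (diag_mat s) = diag_mat s"
    by (simp add: vec_eq_iff transpose_def diag_mat_def)
  have D_nonneg: "0 \<le> x \<bullet> (diag_mat s *v x)" for x
  proof -
    have "x \<bullet> (diag_mat s *v x) = (\<Sum>j\<in>UNIV. s $ j * (x $ j)\<^sup>2)"
      by (simp add: diag_mat_mult inner_vec_def power2_eq_square mult.left_commute)
    also have "\<dots> \<ge> 0"
      using diag by (intro sum_nonneg mult_nonneg_nonneg) (simp_all add: assms(3) less_imp_le)
    finally show ?thesis .
  qed
  have "pos_semidef (\<Sigma> - (\<Sigma> - diag_mat s))"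
    using D_sym D_nonneg by (simp add: pos_semidef_def)
  moreover have "pos_semidef (\<Sigma> + (\<Sigma> - diag_mat s))"
  proof -
    have "transpose (\<Sigma> + (\<Sigma> - diag_mat s)) = \<Sigma> + (\<Sigma> - diag_mat s)"
      using assms(1) D_sym by (simp add: pos_def_def vec_eq_iff transpose_def)
    moreover have "0 \<le> x \<bullet> ((\<Sigma> + (\<Sigma> - diag_mat s)) *v x)" for x
      using quadratic_form_ge_diag_inverse[OF assms(1) inv diag le assms(3), of x]
      unfolding matrix_vector_mult_add_rdistrib matrix_vector_mult_diff_rdistrib
        inner_add_right inner_diff_right by simp
    ultimately show ?thesis by (simp add: pos_semidef_def)
  qed
  ultimately show ?thesis by (intro pos_semidef_block_mat)
qed

end
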